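(* For every integer $k \ge 3$, there exists a graph $G$ such that $G \nrightarrow K_{k}$ and $G \rightarrow (K_{s},K_{k-1})$, where $s=R(k)-1$.
   Context: For positive integers $a,b$ and a graph $G$, we write $G \rightarrow (K_a,K_b)$ if every colouring of the edges of $G$ with red and blue contains a red copy of $K_a$ or a blue copy of $K_b$, and $G\nrightarrow (K_a,K_b)$ otherwise. We write $G\rightarrow K_k$ for $G\rightarrow (K_k,K_k)$. The Ramsey number $R(k)$ is the minimum $n$ such that $K_n \rightarrow K_k$. *)

theory Defs
  imports "HOL-Library.Ramsey"
begin

type_synonym 'a graph = "'a set \<times> 'a set set"

definition simple_graph :: "'a graph \<Rightarrow> bool" where
  "simple_graph G \<longleftrightarrow> finite (fst G) \<and> snd G \<subseteq> [fst G]\<^bsup>2\<^esup>"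

definition complete_graph :: "nat \<Rightarrow> nat graph" where
  "complete_graph n = ({..<n}, [{..<n}]\<^bsup>2\<^esup>)"

datatype colour = Red | Blue

definition has_coloured_clique :: "'a graph \<Rightarrow> ('a set \<Rightarrow> colour) \<Rightarrow> colour \<Rightarrow> nat \<Rightarrow> bool" where
  "has_coloured_clique G f c m \<longleftrightarrow> (\<exists>K \<in> [fst G]\<^bsup>m\<^esup>. clique K {e \<in> snd G. f e = c})"

text \<open>Colourings are total functions on vertex sets; only their values on the edges of \<open>G\<close> matter.\<close>

definition arrows :: "'a graph \<Rightarrow> nat \<Rightarrow> nat \<Rightarrow> bool" where
  "arrows G a b \<longleftrightarrow>
    (\<forall>f. has_coloured_clique G f Red a \<or> has_coloured_clique G f Blue b)"

definition ramsey_number :: "nat \<Rightarrow> nat" where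
  "ramsey_number k = (LEAST n. arrows (complete_graph n) k k)"

text \<open>By Ramsey's theorem the minimum is attained.\<close>

lemma arrows_ramsey_number: "arrows (complete_graph (ramsey_number k)) k k"
proof -
  obtain r where r: "\<And>(V::nat set) E. finite V \<Longrightarrow> card V \<ge> r \<Longrightarrow>
      \<exists>R \<subseteq> V. card R = k \<and> clique R E \<or> card R = k \<and> indep R E"
    using ramsey2[where 'a = nat and m = k and n = k] by blast
  have "has_coloured_clique (complete_graph r) f Red k \<or>
      has_coloured_clique (complete_graph r) f Blue k" for f
  proof -
    obtain R where R: "R \<subseteq> {..<r}" "card R = k"
      and cases: "clique R {e. f e = Red} \<or> indep R {e. f e = Red}"
      using r[of "{..<r}" "{e. f e = Red}"] by auto
    have R_in: "R \<in> [{..<r}]\<^bsup>k\<^esup>"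
      using R by (auto simp: nsets_def intro: finite_subset)
    have not_Red: "f e = Blue" if "f e \<noteq> Red" for e
      using that by (cases "f e") auto
    from cases show ?thesis
    proof
      assume "clique R {e. f e = Red}"
      with R have "clique R {e \<in> [{..<r}]\<^bsup>2\<^esup>. f e = Red}"
        by (auto simp: clique_def)
      with R_in show ?thesis
        by (auto simp: has_coloured_clique_def complete_graph_def)
    next
      assume "indep R {e. f e = Red}"
      with R not_Red have "clique R {e \<in> [{..<r}]\<^bsup>2\<^esup>. f e = Blue}"
        by (auto simp: clique_def indep_def)
      with R_in show ?thesis
        by (auto simp: has_coloured_clique_def complete_graph_def)
    qed
  qed
  then have "arrows (complete_graph r) k k"
    by (simp add: arrows_def)
  then show ?thesis
    unfolding ramsey_number_def by (rule LeastI)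
qed

end

theory Submission
  imports Defs "HOL-Library.Countable"
begin

text \<open>Fix a critical colouring of \<open>K\<^sub>s\<close>, i.e. one without monochromatic \<open>K\<^sub>k\<close>; by minimality of
  \<open>R(k)\<close> it contains a clique on \<open>k - 1\<close> vertices in each colour. The partite construction of
  Nesetril and Rodl embeds it into a finite graph that is again edge-coloured without
  monochromatic \<open>K\<^sub>k\<close>, such that every further 2-colouring of the edges is constant on each
  original colour class of some copy of the critical colouring. If both classes of
  this copy become red, it is a red \<open>K\<^sub>s\<close>; otherwise one class becomes blue and contains the
  desired blue clique on \<open>k - 1\<close> vertices. One step of the construction makes the colour depend
  only on a given pair of parts; there the bipartite graph between two parts is replaced by a power
  of itself, to which the Hales--Jewett theorem is applied with the edges as alphabet.\<close>

section \<open>The Hales--Jewett theorem\<close>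

text \<open>A list over \<open>'a option\<close> is a variable word: \<open>None\<close> is the
  variable, and all its occurrences receive the same letter.\<close>

definition instantiate :: "'a option list \<Rightarrow> 'a \<Rightarrow> 'a list" where
  "instantiate w a = map (case_option a id) w"

definition combinatorial_line :: "'a set \<Rightarrow> nat \<Rightarrow> 'a option list \<Rightarrow> bool" where
  "combinatorial_line A N w \<longleftrightarrow>
     length w = N \<and> None \<in> set w \<and> set w \<subseteq> insert None (Some ` A)"

text \<open>Colourings are taken on all lists; only words of length \<open>N\<close> over
  \<open>A\<close> matter. Any sufficient dimension counts, not just the least one.\<close>

definition hales_jewett_number :: "'a set \<Rightarrow> nat \<Rightarrow> nat \<Rightarrow> bool" where
  "hales_jewett_number A r N \<longleftrightarrow>
     (\<forall>\<chi>. (\<forall>u. \<chi> u < r) \<longrightarrow>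
       (\<exists>w c. combinatorial_line A N w \<and> (\<forall>a\<in>A. \<chi> (instantiate w a) = c)))"

text \<open>Colour-focused lines: \<open>F\<close> is the common end point of the lines at the
  letter \<open>b\<close>. Indexing the lines by their colours in \<open>C\<close> makes these
  colours distinct by construction.\<close>

definition focused_family ::
    "('a list \<Rightarrow> nat) \<Rightarrow> 'a \<Rightarrow> 'a set \<Rightarrow> nat \<Rightarrow> 'a list \<Rightarrow> nat set \<Rightarrow> bool" where
  "focused_family \<chi> b A N F C \<longleftrightarrow> length F = N \<and> set F \<subseteq> insert b A \<and> \<chi> F \<notin> C \<and>
     (\<forall>c\<in>C. \<exists>w. combinatorial_line (insert b A) N w \<and> instantiate w b = F \<and>
        (\<forall>a\<in>A. \<chi> (instantiate w a) = c))"

lemma instantiate_append [simp]: "instantiate (v @ w) a = instantiate v a @ instantiate w a"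
  by (simp add: instantiate_def)

lemma instantiate_map_Some [simp]: "instantiate (map Some u) a = u"
  by (simp add: instantiate_def comp_def)

lemma length_instantiate [simp]: "length (instantiate w a) = length w"
  by (simp add: instantiate_def)

lemma set_instantiate:
  assumes "combinatorial_line A N w"
  shows "set (instantiate w a) \<subseteq> insert a A"
  using assms by (auto simp: instantiate_def combinatorial_line_def split: option.splits)

lemma combinatorial_line_mono:
  "combinatorial_line A N w \<Longrightarrow> A \<subseteq> B \<Longrightarrow> combinatorial_line B N w"
  unfolding combinatorial_line_def by (meson image_mono insert_mono order_trans)

lemma combinatorial_line_append:
  assumes "combinatorial_line A M v" "combinatorial_line A N w"
  shows "combinatorial_line A (M + N) (v @ w)"
  using assms by (auto simp: combinatorial_line_def)

lemma combinatorial_line_append_word: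
  assumes "combinatorial_line A M v" "length u = N" "set u \<subseteq> A"
  shows "combinatorial_line A (M + N) (v @ map Some u)"
  using assms by (auto simp: combinatorial_line_def)

lemma combinatorial_line_word_append:
  assumes "combinatorial_line A N w" "length u = M" "set u \<subseteq> A"
  shows "combinatorial_line A (M + N) (map Some u @ w)"
  using assms by (auto simp: combinatorial_line_def)

text \<open>Colour a word \<open>u\<close> by the whole function \<open>v \<mapsto> \<chi> (u @ v)\<close>.\<close>

lemma hales_jewett_line_uniform_in_suffix:
  fixes A B :: "'a set" and r :: nat
  assumes A: "\<And>r. \<exists>M. hales_jewett_number A r M" and "finite B"
  shows "\<exists>M. \<forall>\<chi>. (\<forall>u. \<chi> u < r) \<longrightarrow>
    (\<exists>w. combinatorial_line A M w \<and>
      (\<forall>a\<in>A. \<forall>a'\<in>A. \<forall>v. length v = N \<and> set v \<subseteq> B \<longrightarrow>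
         \<chi> (instantiate w a @ v) = \<chi> (instantiate w a' @ v)))"
proof -
  have "finite {v. set v \<subseteq> B \<and> length v = N}"
    using \<open>finite B\<close> by (rule finite_lists_length_eq)
  from finite_list[OF this] obtain vs where vs: "set vs = {v. set v \<subseteq> B \<and> length v = N}" ..
  \<comment> \<open>Hales-Jewett colours are numbers, so the tuple of colours over all suffixes in
    \<open>vs\<close> is coded by a number below \<open>card S\<close>.\<close>
  define S where "S = {l. set l \<subseteq> {..<r} \<and> length l = length vs}"
  have "finite S"
    unfolding S_def by (rule finite_lists_length_eq) simp
  then obtain g :: "nat list \<Rightarrow> nat" where g: "bij_betw g S {0..<card S}"
    using ex_bij_betw_finite_nat by blast
  obtain M where M: "hales_jewett_number A (card S) M"
    using A by blast
  have "\<exists>w. combinatorial_line A M w \<and>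
      (\<forall>a\<in>A. \<forall>a'\<in>A. \<forall>v. length v = N \<and> set v \<subseteq> B \<longrightarrow>
         \<chi> (instantiate w a @ v) = \<chi> (instantiate w a' @ v))"
    if \<chi>: "\<forall>u. \<chi> u < r" for \<chi>
  proof -
    define h where "h u = map (\<lambda>v. \<chi> (u @ v)) vs" for u
    have hS: "h u \<in> S" for u
      using \<chi> by (auto simp: h_def S_def)
    then have "\<forall>u. g (h u) < card S"
      using g by (meson atLeastLessThan_iff bij_betwE)
    then obtain w c where w: "combinatorial_line A M w"
      and c: "\<forall>a\<in>A. g (h (instantiate w a)) = c"
      using M[unfolded hales_jewett_number_def, rule_format, of "\<lambda>u. g (h u)"] by blast
    have "h (instantiate w a) = h (instantiate w a')" if "a \<in> A" "a' \<in> A" for a a'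
      using c that hS g by (metis bij_betw_imp_inj_on inj_onD)
    then have "\<chi> (instantiate w a @ v) = \<chi> (instantiate w a' @ v)"
      if "a \<in> A" "a' \<in> A" "length v = N" "set v \<subseteq> B" for a a' v
      using that vs unfolding h_def map_eq_conv by blast
    with w show ?thesis by blast
  qed
  then show ?thesis by blast
qed

text \<open>Each old line \<open>v\<close> becomes \<open>w @ v\<close>, moving in both blocks;
  uniformity of \<open>w\<close> keeps its colour. The new line \<open>w @ map Some F\<close> moves
  only in the first block and has the colour of the old focus, which is outside \<open>C\<close>.
  All these lines end in \<open>instantiate w b @ F\<close>; if that word had one of their colours,
  the line concerned would be monochromatic over \<open>insert b A\<close>.\<close>

lemma focused_family_extend:
  assumes w: "combinatorial_line A M w" and a0: "a0 \<in> A"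
    and uniform: "\<And>a v. a \<in> A \<Longrightarrow> length v = N \<Longrightarrow> set v \<subseteq> insert b A \<Longrightarrow>
        \<chi> (instantiate w a @ v) = \<chi> (instantiate w a0 @ v)"
    and foc: "focused_family (\<lambda>v. \<chi> (instantiate w a0 @ v)) b A N F C"
    and no_line: "\<nexists>v c. combinatorial_line (insert b A) (M + N) v \<and>
        (\<forall>a\<in>insert b A. \<chi> (instantiate v a) = c)"
  shows "focused_family \<chi> b A (M + N) (instantiate w b @ F)
           (insert (\<chi> (instantiate w a0 @ F)) C)"
proof -
  let ?B = "insert b A" and ?G = "instantiate w b @ F"
  have wB: "combinatorial_line ?B M w"
    using w by (rule combinatorial_line_mono) blast
  have F: "length F = N" "set F \<subseteq> ?B"
    using foc by (auto simp: focused_family_def)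
  have lines: "\<exists>v. combinatorial_line ?B (M + N) v \<and> instantiate v b = ?G \<and>
      (\<forall>a\<in>A. \<chi> (instantiate v a) = c)"
    if "c \<in> insert (\<chi> (instantiate w a0 @ F)) C" for c
    using that
  proof
    assume c: "c = \<chi> (instantiate w a0 @ F)"
    have "combinatorial_line ?B (M + N) (w @ map Some F)"
      using wB F by (rule combinatorial_line_append_word)
    with c uniform F show ?thesis
      by (intro exI[of _ "w @ map Some F"]) simp
  next
    assume "c \<in> C"
    then obtain v where v: "combinatorial_line ?B N v" "instantiate v b = F"
      and c: "\<forall>a\<in>A. \<chi> (instantiate w a0 @ instantiate v a) = c"
      using foc by (auto simp: focused_family_def)
    have "\<chi> (instantiate w a @ instantiate v a) = c" if "a \<in> A" for a
    proof -
      have "length (instantiate v a) = N" "set (instantiate v a) \<subseteq> ?B"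
        using v(1) set_instantiate[OF v(1), of a] that
        by (auto simp: combinatorial_line_def)
      then show ?thesis using uniform[OF that] c that by simp
    qed
    with v combinatorial_line_append[OF wB v(1)] show ?thesis
      by (intro exI[of _ "w @ v"]) simp
  qed
  have "\<chi> ?G \<notin> insert (\<chi> (instantiate w a0 @ F)) C"
    using lines no_line by (metis insertE)
  moreover have "length ?G = M + N" "set ?G \<subseteq> ?B"
    using F w set_instantiate[OF wB, of b] by (auto simp: combinatorial_line_def)
  ultimately show ?thesis
    using lines unfolding focused_family_def by blast
qed

text \<open>Induction on the number \<open>m\<close> of focused colours. The suffix length
  \<open>N\<close> comes from the induction hypothesis; only then is the prefix length
  \<open>M\<close> chosen, large enough for a line over \<open>A\<close> that no suffix of length
  \<open>N\<close> distinguishes.\<close>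

lemma colour_focusing:
  fixes A :: "'a set"
  assumes A: "\<And>r. \<exists>M. hales_jewett_number A r M" and "A \<noteq> {}" and "finite A"
  shows "\<exists>N. \<forall>\<chi>. (\<forall>u. \<chi> u < r) \<longrightarrow>
    (\<exists>w c. combinatorial_line (insert b A) N w \<and>
        (\<forall>a\<in>insert b A. \<chi> (instantiate w a) = c)) \<or>
    (\<exists>F C. finite C \<and> card C = m \<and> C \<subseteq> {..<r} \<and> focused_family \<chi> b A N F C)"
proof (induction m)
  case 0
  have "focused_family \<chi> b A 0 [] {}" for \<chi> :: "'a list \<Rightarrow> nat"
    by (simp add: focused_family_def)
  then show ?case
    by (metis card.empty empty_subsetI finite.emptyI)
next
  case (Suc m)
  let ?B = "insert b A"
  let ?mono = "\<lambda>\<chi> N. \<exists>w c. combinatorial_line ?B N w \<and> (\<forall>a\<in>?B. \<chi> (instantiate w a) = c)"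
  obtain N where N: "\<And>\<chi>. (\<forall>u. \<chi> u < r) \<Longrightarrow> ?mono \<chi> N \<or>
      (\<exists>F C. finite C \<and> card C = m \<and> C \<subseteq> {..<r} \<and> focused_family \<chi> b A N F C)"
    using Suc.IH by blast
  obtain M where M: "\<And>\<chi>. (\<forall>u. \<chi> u < r) \<Longrightarrow> \<exists>w. combinatorial_line A M w \<and>
      (\<forall>a\<in>A. \<forall>a'\<in>A. \<forall>v. length v = N \<and> set v \<subseteq> ?B \<longrightarrow>
         \<chi> (instantiate w a @ v) = \<chi> (instantiate w a' @ v))"
    using hales_jewett_line_uniform_in_suffix[OF A, of ?B r N] \<open>finite A\<close> by auto
  obtain a0 where a0: "a0 \<in> A" using \<open>A \<noteq> {}\<close> by blast
  have "\<exists>F C. finite C \<and> card C = Suc m \<and> C \<subseteq> {..<r} \<and>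
      focused_family \<chi> b A (M + N) F C"
    if \<chi>: "\<forall>u. \<chi> u < r" and no_line: "\<not> ?mono \<chi> (M + N)" for \<chi>
  proof -
    obtain w where w: "combinatorial_line A M w"
      and uniform: "\<And>a v. a \<in> A \<Longrightarrow> length v = N \<Longrightarrow> set v \<subseteq> ?B \<Longrightarrow>
         \<chi> (instantiate w a @ v) = \<chi> (instantiate w a0 @ v)"
      using M[OF \<chi>] a0 by blast
    let ?\<chi> = "\<lambda>v. \<chi> (instantiate w a0 @ v)"
    have u0: "length (instantiate w a0) = M" "set (instantiate w a0) \<subseteq> ?B"
      using w set_instantiate[OF w, of a0] a0 by (auto simp: combinatorial_line_def)
    \<comment> \<open>A monochromatic line for the restricted colouring would become one for
      \<open>\<chi>\<close> after prefixing the constant word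
      \<open>instantiate w a0\<close>.\<close>
    have "\<not> ?mono ?\<chi> N"
    proof
      assume "?mono ?\<chi> N"
      then obtain v c where v: "combinatorial_line ?B N v"
        and c: "\<forall>a\<in>?B. ?\<chi> (instantiate v a) = c" by blast
      have "combinatorial_line ?B (M + N) (map Some (instantiate w a0) @ v)"
        using v u0 by (rule combinatorial_line_word_append)
      moreover have
        "\<forall>a\<in>?B. \<chi> (instantiate (map Some (instantiate w a0) @ v) a) = c"
        using c by simp
      ultimately show False using no_line by blast
    qed
    then obtain F C where C: "finite C" "card C = m" "C \<subseteq> {..<r}"
      and foc: "focused_family ?\<chi> b A N F C"
      using N[of ?\<chi>] \<chi> by blast
    have "?\<chi> F \<notin> C" using foc by (simp add: focused_family_def)
    with C \<chi> have "finite (insert (?\<chi> F) C)" "card (insert (?\<chi> F) C) = Suc m"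
      "insert (?\<chi> F) C \<subseteq> {..<r}" by auto
    moreover have "focused_family \<chi> b A (M + N) (instantiate w b @ F) (insert (?\<chi> F) C)"
      using w a0 uniform foc no_line by (rule focused_family_extend)
    ultimately show "\<exists>F C. finite C \<and> card C = Suc m \<and> C \<subseteq> {..<r} \<and>
        focused_family \<chi> b A (M + N) F C"
      by blast
  qed
  then show ?case by blast
qed

text \<open>Induction on the alphabet. With \<open>r\<close> focused colours out of
  \<open>r\<close>, no colour is left for the focus, so the monochromatic alternative of colour
  focusing must occur.\<close>

theorem hales_jewett:
  assumes "finite A" "A \<noteq> {}"
  shows "\<exists>N. hales_jewett_number A r N"
  using assms
proof (induction A arbitrary: r rule: finite_ne_induct)
  case (singleton a)
  have "combinatorial_line {a} 1 [None]" by (simp add: combinatorial_line_def)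
  then show ?case unfolding hales_jewett_number_def by blast
next
  case (insert b A)
  obtain N where N: "\<And>\<chi>. (\<forall>u. \<chi> u < r) \<Longrightarrow>
    (\<exists>w c. combinatorial_line (insert b A) N w \<and>
        (\<forall>a\<in>insert b A. \<chi> (instantiate w a) = c)) \<or>
    (\<exists>F C. finite C \<and> card C = r \<and> C \<subseteq> {..<r} \<and> focused_family \<chi> b A N F C)"
    using colour_focusing[OF insert.IH insert.hyps(2,1), of r b r] by blast
  have "\<exists>w c. combinatorial_line (insert b A) N w \<and>
      (\<forall>a\<in>insert b A. \<chi> (instantiate w a) = c)" if \<chi>: "\<forall>u. \<chi> u < r" for \<chi>
  proof -
    have False if "card C = r" "C \<subseteq> {..<r}" "focused_family \<chi> b A N F C" for F C
    proof -
      have "C = {..<r}" using that by (simp add: card_subset_eq)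
      with that(3) \<chi> show False by (simp add: focused_family_def)
    qed
    with N[OF \<chi>] show ?thesis by blast
  qed
  then show ?case unfolding hales_jewett_number_def by blast
qed

section \<open>Edge-coloured oriented graphs and the partite construction\<close>

definition mono_clique :: "(colour \<Rightarrow> 'a \<Rightarrow> 'a \<Rightarrow> bool) \<Rightarrow> colour \<Rightarrow> 'a set \<Rightarrow> bool" where
  "mono_clique R c K \<longleftrightarrow> (\<forall>x\<in>K. \<forall>y\<in>K. x \<noteq> y \<longrightarrow> R c x y \<or> R c y x)"

text \<open>\<open>R c x y\<close> says that \<open>x y\<close> is an edge of colour \<open>c\<close>, oriented from \<open>x\<close> to \<open>y\<close>;
  \<open>p\<close> assigns to each vertex its part.\<close>

definition admissible ::
    "nat \<Rightarrow> (colour \<Rightarrow> 'a \<Rightarrow> 'a \<Rightarrow> bool) \<Rightarrow> ('a \<Rightarrow> nat) \<Rightarrow> bool" where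
  "admissible k R p \<longleftrightarrow> finite {(c, x, y). R c x y} \<and>
     (\<forall>c x y. R c x y \<longrightarrow> p x < p y) \<and>
     (\<forall>c c' x y. R c x y \<longrightarrow> R c' x y \<longrightarrow> c = c') \<and>
     (\<forall>c K. mono_clique R c K \<longrightarrow> card K \<noteq> k)"

definition coloured_hom ::
    "(colour \<Rightarrow> 'a \<Rightarrow> 'a \<Rightarrow> bool) \<Rightarrow> (colour \<Rightarrow> 'b \<Rightarrow> 'b \<Rightarrow> bool) \<Rightarrow> ('a \<Rightarrow> 'b) \<Rightarrow> bool" where
  "coloured_hom R R' \<phi> \<longleftrightarrow> (\<forall>c x y. R c x y \<longrightarrow> R' c (\<phi> x) (\<phi> y))"

section \<open>Unions of copies of a coloured graph\<close>

definition union_of_copies ::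
    "(colour \<Rightarrow> 'a \<Rightarrow> 'a \<Rightarrow> bool) \<Rightarrow> 'w set \<Rightarrow> ('w \<Rightarrow> 'a \<Rightarrow> 'b) \<Rightarrow> colour \<Rightarrow> 'b \<Rightarrow> 'b \<Rightarrow> bool" where
  "union_of_copies R W \<phi> c u v \<longleftrightarrow> (\<exists>w\<in>W. \<exists>x y. R c x y \<and> u = \<phi> w x \<and> v = \<phi> w y)"

lemma coloured_hom_comp:
  "coloured_hom R S \<phi> \<Longrightarrow> coloured_hom S T \<psi> \<Longrightarrow> coloured_hom R T (\<lambda>x. \<psi> (\<phi> x))"
  by (simp add: coloured_hom_def)

lemma coloured_hom_copy: "w \<in> W \<Longrightarrow> coloured_hom R (union_of_copies R W \<phi>) (\<phi> w)"
  by (auto simp: coloured_hom_def union_of_copies_def)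

text \<open>By \<open>cover\<close>, a monochromatic clique on \<open>k\<close> vertices lies in a
  single copy, and \<open>reflect\<close> pulls it back to one in \<open>R\<close>. Reflection also
  transfers uniqueness of edge colours.\<close>

lemma admissible_union_of_copies:
  assumes R: "admissible k R p" and "finite W"
    and mono: "\<And>w c x y. w \<in> W \<Longrightarrow> R c x y \<Longrightarrow> p' (\<phi> w x) < p' (\<phi> w y)"
    and reflect: "\<And>w c x y. w \<in> W \<Longrightarrow> union_of_copies R W \<phi> c (\<phi> w x) (\<phi> w y) \<Longrightarrow> R c x y"
    and cover: "\<And>c K. mono_clique (union_of_copies R W \<phi>) c K \<Longrightarrow> card K = k \<Longrightarrow>
                  \<exists>w\<in>W. K \<subseteq> range (\<phi> w)"
  shows "admissible k (union_of_copies R W \<phi>) p'"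
  unfolding admissible_def
proof (intro conjI allI impI)
  let ?R = "union_of_copies R W \<phi>"
  have "{(c, u, v). ?R c u v} \<subseteq>
      (\<lambda>(w, c, x, y). (c, \<phi> w x, \<phi> w y)) ` (W \<times> {(c, x, y). R c x y})"
    by (force simp: union_of_copies_def)
  moreover have "finite (W \<times> {(c, x, y). R c x y})"
    using R \<open>finite W\<close> by (simp add: admissible_def)
  ultimately show "finite {(c, u, v). ?R c u v}"
    by (meson finite_imageI finite_subset)
  show "p' u < p' v" if "?R c u v" for c u v
    using that mono by (auto simp: union_of_copies_def)
  show "c = c'" if "?R c u v" "?R c' u v" for c c' u v
  proof -
    from that(1) obtain w x y where w: "w \<in> W" "R c x y" "u = \<phi> w x" "v = \<phi> w y"
      by (auto simp: union_of_copies_def)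
    with that(2) reflect have "R c' x y" by blast
    with w(2) R show ?thesis unfolding admissible_def by blast
  qed
  show "card K \<noteq> k" if K: "mono_clique ?R c K" for c K
  proof
    assume k: "card K = k"
    with K cover obtain w where w: "w \<in> W" "K \<subseteq> range (\<phi> w)" by blast
    \<comment> \<open>\<open>inv (\<phi> w)\<close> is a section of the copy map over
      \<open>K\<close>, hence injective there, so \<open>K0\<close> still has \<open>k\<close>
      elements.\<close>
    define K0 where "K0 = inv (\<phi> w) ` K"
    have sec: "\<phi> w (inv (\<phi> w) u) = u" if "u \<in> K" for u
      using that w(2) by (auto intro: f_inv_into_f)
    then have "inj_on (inv (\<phi> w)) K" by (metis inj_onI)
    then have "card K0 = k" using k by (simp add: K0_def card_image)
    moreover have "mono_clique R c K0"
      unfolding mono_clique_def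
    proof (intro ballI impI)
      fix x y assume xy: "x \<in> K0" "y \<in> K0" "x \<noteq> y"
      then have "\<phi> w x \<in> K" "\<phi> w y \<in> K" "\<phi> w x \<noteq> \<phi> w y"
        using sec by (auto simp: K0_def)
      then have "?R c (\<phi> w x) (\<phi> w y) \<or> ?R c (\<phi> w y) (\<phi> w x)"
        using K by (simp add: mono_clique_def)
      then show "R c x y \<or> R c y x" using reflect w(1) by blast
    qed
    ultimately show False using R unfolding admissible_def by blast
  qed
qed

lemma mono_clique_neighbour:
  assumes "mono_clique R c K" "card K \<ge> 2" "u \<in> K"
  obtains v where "v \<in> K" "v \<noteq> u" "R c u v \<or> R c v u"
proof -
  have "\<not> K \<subseteq> {u}"
    using assms(2) card_mono[of "{u}" K] by auto
  then show thesis using that assms(1,3) unfolding mono_clique_def by blast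
qed

text \<open>Gluing changes the vertex type; coding the vertices by natural numbers returns to a
  fixed type, so that the construction can be iterated.\<close>

lemma admissible_relabel:
  fixes R :: "colour \<Rightarrow> 'a::countable \<Rightarrow> 'a \<Rightarrow> bool"
  assumes R: "admissible k R p" and "k \<ge> 2"
  obtains R' :: "colour \<Rightarrow> nat \<Rightarrow> nat \<Rightarrow> bool" and p'
  where "admissible k R' p'" "coloured_hom R R' to_nat" "\<And>x. p' (to_nat x) = p x"
proof
  let ?R = "union_of_copies R {()} (\<lambda>_. to_nat)"
  show "admissible k ?R (p \<circ> from_nat)"
  proof (rule admissible_union_of_copies[OF R])
    fix c and K :: "nat set"
    assume K: "mono_clique ?R c K" "card K = k"
    \<comment> \<open>A clique vertex lies on an edge because \<open>k \<ge> 2\<close>, and all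
      edges of the relabelled graph join codes of vertices.\<close>
    have "u \<in> range (to_nat :: 'a \<Rightarrow> nat)" if "u \<in> K" for u
      using mono_clique_neighbour[OF K(1) _ that] K(2) \<open>k \<ge> 2\<close>
      by (auto simp: union_of_copies_def)
    then show "\<exists>w\<in>{()}. K \<subseteq> range (to_nat :: 'a \<Rightarrow> nat)" by auto
  qed (use R in \<open>auto simp: admissible_def union_of_copies_def\<close>)
  show "coloured_hom R ?R to_nat" by (auto simp: coloured_hom_def union_of_copies_def)
qed simp

text \<open>Gluing map of the partite step: the copy of the graph indexed by the combinatorial line
  \<open>w\<close> (over the edges between the parts \<open>i\<close> and \<open>j\<close>) shares its parts \<open>i\<close> and \<open>j\<close>, sitting
  inside powers of these parts, with the other copies, and is disjoint from them elsewhere.\<close>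

definition glue :: "('a \<Rightarrow> nat) \<Rightarrow> nat \<Rightarrow> nat \<Rightarrow> ('a \<times> 'a) option list \<Rightarrow> 'a \<Rightarrow>
    (nat \<times> 'a list) + (('a \<times> 'a) option list \<times> 'a)" where
  "glue p i j w x =
     (if p x = i then Inl (i, map (case_option x fst) w)
      else if p x = j then Inl (j, map (case_option x snd) w)
      else Inr (w, x))"

definition glued_part :: "('a \<Rightarrow> nat) \<Rightarrow> (nat \<times> 'a list) + (('a \<times> 'a) option list \<times> 'a) \<Rightarrow> nat" where
  "glued_part p u = (case u of Inl (t, _) \<Rightarrow> t | Inr (_, x) \<Rightarrow> p x)"

lemma glued_part_glue [simp]: "glued_part p (glue p i j w x) = p x"
  by (simp add: glued_part_def glue_def)

text \<open>In the parts \<open>i\<close> and \<open>j\<close>, a position where \<open>w\<close> is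
  \<open>None\<close> records the vertex itself; elsewhere \<open>Inr\<close> does.\<close>

lemma glue_inject:
  assumes "None \<in> set w" "glue p i j w x = glue p i j w y"
  shows "x = y"
proof -
  have eq: "x = y" if "map (case_option x g) w = map (case_option y g) w"
    for g :: "'a \<times> 'a \<Rightarrow> 'a"
    using that assms(1) by (metis (no_types, lifting) map_eq_conv option.case(1))
  then show ?thesis using assms(2) by (auto simp: glue_def split: if_splits)
qed

lemma glue_eq_Inr: "Inr (w, x) = glue p i j w' y \<longleftrightarrow> p y \<noteq> i \<and> p y \<noteq> j \<and> w = w' \<and> x = y"
  by (auto simp: glue_def)

text \<open>An edge between images in copy \<open>w\<close> might stem from another copy
  \<open>w'\<close>. An endpoint outside the parts \<open>i\<close> and \<open>j\<close> carries its
  line as a tag, which forces \<open>w' = w\<close>. If both endpoints lie in the shared parts, the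
  two lines are compared position by position.\<close>

lemma glue_reflects_edges:
  assumes R: "admissible k R p"
    and W: "W \<subseteq> {w. combinatorial_line {(x, y). R c0 x y \<and> p x = i \<and> p y = j} N w}"
    and "i < j" "w \<in> W"
    and edge: "union_of_copies R W (glue p i j) c (glue p i j w x) (glue p i j w y)"
  shows "R c x y"
proof -
  let ?A = "{(x, y). R c0 x y \<and> p x = i \<and> p y = j}"
  from edge obtain w' x' y' where w': "w' \<in> W" and R': "R c x' y'"
    and x: "glue p i j w x = glue p i j w' x'" and y: "glue p i j w y = glue p i j w' y'"
    by (auto simp: union_of_copies_def)
  have line: "length v = N" "None \<in> set v" "set v \<subseteq> insert None (Some ` ?A)" if "v \<in> W" for v
    using that W by (auto simp: combinatorial_line_def)
  have px: "p x' = p x" and py: "p y' = p y"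
    using x y by (metis glued_part_glue)+
  have lt: "p x < p y" using R R' px py unfolding admissible_def by metis
  \<comment> \<open>Edges go from smaller to larger parts, so two endpoints in the shared parts can
    only lie in \<open>i\<close> and \<open>j\<close> in this order.\<close>
  consider "p x \<notin> {i, j} \<or> p y \<notin> {i, j}" | "p x = i" "p y = j"
    using lt \<open>i < j\<close> by fastforce
  then show ?thesis
  proof cases
    case 1
    then have "w' = w" using x y px py by (auto simp: glue_def split: if_splits)
    then have "x' = x" "y' = y" using x y glue_inject line(2)[OF \<open>w \<in> W\<close>] by metis+
    with R' show ?thesis by simp
  next
    case 2
    have mx: "map (case_option x fst) w = map (case_option x' fst) w'"
      using x px 2 by (simp add: glue_def)
    have my: "map (case_option y snd) w = map (case_option y' snd) w'"
      using y py 2 \<open>i < j\<close> by (simp add: glue_def)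
    have pos: "case_option x fst (w ! n) = case_option x' fst (w' ! n)"
      "case_option y snd (w ! n) = case_option y' snd (w' ! n)" if "n < N" for n
      using mx my that line(1)[OF \<open>w \<in> W\<close>] line(1)[OF w'] by (metis nth_map)+
    have fixed: "R c0 (fst e) (snd e)" if "v \<in> W" "n < N" "v ! n = Some e" for v n e
    proof -
      have "Some e \<in> set v" using that line(1)[OF that(1)] by (metis nth_mem)
      then show ?thesis using line(3)[OF that(1)] by auto
    qed
    \<comment> \<open>At \<open>m\<close>, where \<open>w\<close> moves, \<open>w'\<close> either
      moves too, so that the two edges coincide, or holds a letter, so that \<open>(x, y)\<close> is
      a \<open>c0\<close>-edge. Symmetrically, \<open>m'\<close> makes \<open>(x', y')\<close> equal
      to \<open>(x, y)\<close> or a \<open>c0\<close>-edge. If both are \<open>c0\<close>-edges,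
      uniqueness of colours gives \<open>c = c0\<close>.\<close>
    obtain m where m: "m < N" "w ! m = None"
      using line(1,2)[OF \<open>w \<in> W\<close>] by (metis in_set_conv_nth)
    obtain m' where m': "m' < N" "w' ! m' = None"
      using line(1,2)[OF w'] by (metis in_set_conv_nth)
    show ?thesis
    proof (cases "w' ! m")
      case None
      then show ?thesis using pos[OF m(1)] m R' by simp
    next
      case (Some e)
      then have xy: "R c0 x y" using pos[OF m(1)] m fixed[OF w' m(1) Some] by simp
      show ?thesis
      proof (cases "w ! m'")
        case None
        then show ?thesis using pos[OF m'(1)] m' R' by simp
      next
        case (Some e')
        then have "R c0 x' y'" using pos[OF m'(1)] m' fixed[OF \<open>w \<in> W\<close> m'(1) Some] by simp
        then have "c = c0" using R R' unfolding admissible_def by blast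
        with xy show ?thesis by simp
      qed
    qed
  qed
qed

text \<open>The vertices of a clique lie in distinct parts, so among at least three there is one
  outside \<open>i\<close> and \<open>j\<close>. It belongs to a single copy, and so do all its
  edges, which reach the whole clique.\<close>

lemma glue_covers_cliques:
  assumes R: "admissible k R p" and "k \<ge> 3"
    and K: "mono_clique (union_of_copies R W (glue p i j)) c K" "card K = k"
  shows "\<exists>w\<in>W. K \<subseteq> range (glue p i j w)"
proof -
  let ?R = "union_of_copies R W (glue p i j)"
  have part_inj: "inj_on (glued_part p) K"
  proof (rule inj_onI, rule ccontr)
    fix u v assume uv: "u \<in> K" "v \<in> K" "glued_part p u = glued_part p v" "u \<noteq> v"
    then have "?R c u v \<or> ?R c v u" using K(1) by (simp add: mono_clique_def)
    then obtain w x y where "R c x y" "{u, v} = {glue p i j w x, glue p i j w y}"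
      unfolding union_of_copies_def by blast
    then have "p x = p y" using uv(3) by (auto simp: doubleton_eq_iff)
    with \<open>R c x y\<close> R show False unfolding admissible_def by (metis less_irrefl)
  qed
  have "\<not> glued_part p ` K \<subseteq> {i, j}"
  proof
    assume "glued_part p ` K \<subseteq> {i, j}"
    then have "card (glued_part p ` K) \<le> card {i, j}" by (rule card_mono[rotated]) simp
    also have "\<dots> \<le> 2" by (simp add: card_insert_if)
    finally show False using card_image[OF part_inj] K(2) \<open>k \<ge> 3\<close> by simp
  qed
  then obtain u where u: "u \<in> K" "glued_part p u \<notin> {i, j}" by blast
  obtain v where "?R c u v \<or> ?R c v u"
    using mono_clique_neighbour[OF K(1) _ u(1)] K(2) \<open>k \<ge> 3\<close> by auto
  then obtain w x where w: "w \<in> W" "u = glue p i j w x"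
    by (auto simp: union_of_copies_def)
  with u(2) have u_eq: "u = Inr (w, x)"
    using glued_part_glue[of p i j w x] by (simp add: glue_def)
  have "v \<in> range (glue p i j w)" if "v \<in> K" for v
  proof (cases "v = u")
    case False
    then have "?R c u v \<or> ?R c v u" using K(1) u(1) that by (simp add: mono_clique_def)
    then show ?thesis unfolding u_eq union_of_copies_def glue_eq_Inr by blast
  qed (use w in blast)
  with w(1) show ?thesis by blast
qed

text \<open>The copies are indexed by the combinatorial lines over the alphabet of
  \<open>c0\<close>-edges between the parts \<open>i\<close> and \<open>j\<close>; a line
  monochromatic for the colouring induced by \<open>f\<close> names the desired copy.\<close>

lemma partite_step:
  fixes R :: "colour \<Rightarrow> nat \<Rightarrow> nat \<Rightarrow> bool"
  assumes R: "admissible k R p" and "k \<ge> 3"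
  shows "\<exists>(R' :: colour \<Rightarrow> nat \<Rightarrow> nat \<Rightarrow> bool) p'. admissible k R' p' \<and>
    (\<forall>f :: nat \<Rightarrow> nat \<Rightarrow> colour. \<exists>\<phi> d. coloured_hom R R' \<phi> \<and> (\<forall>x. p' (\<phi> x) = p x) \<and>
       (\<forall>x y. R c0 x y \<longrightarrow> p x = i \<longrightarrow> p y = j \<longrightarrow> f (\<phi> x) (\<phi> y) = d))"
proof (cases "\<exists>x y. R c0 x y \<and> p x = i \<and> p y = j")
  case False
  \<comment> \<open>Without such edges there is nothing to make constant, and \<open>R\<close>
    serves as its own extension.\<close>
  then show ?thesis using R
    by (intro exI[of _ R] exI[of _ p] conjI allI exI[of _ "\<lambda>x. x"])
      (auto simp: coloured_hom_def)
next
  case True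
  define A where "A = {(x, y). R c0 x y \<and> p x = i \<and> p y = j}"
  have "A \<noteq> {}" using True by (auto simp: A_def)
  have "i < j" using True R by (auto simp: admissible_def)
  have "A \<subseteq> snd ` {(c, x, y). R c x y}" by (force simp: A_def)
  then have "finite A" using R by (metis admissible_def finite_imageI finite_subset)
  obtain N where N: "hales_jewett_number A 2 N"
    using hales_jewett \<open>finite A\<close> \<open>A \<noteq> {}\<close> by blast
  define W where "W = {w. combinatorial_line A N w}"
  have "W \<subseteq> {w. set w \<subseteq> insert None (Some ` A) \<and> length w = N}"
    by (auto simp: W_def combinatorial_line_def)
  then have "finite W"
    by (rule finite_subset) (simp add: finite_lists_length_eq \<open>finite A\<close>)
  let ?R = "union_of_copies R W (glue p i j)"
  have "admissible k ?R (glued_part p)"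
  proof (rule admissible_union_of_copies[OF R \<open>finite W\<close>])
    show "glued_part p (glue p i j w x) < glued_part p (glue p i j w y)" if "R c x y" for w c x y
      using that R by (simp add: admissible_def)
    show "R c x y" if "w \<in> W" "?R c (glue p i j w x) (glue p i j w y)" for w c x y
      using glue_reflects_edges[OF R _ \<open>i < j\<close> that, of c0 N] by (simp add: W_def A_def)
    show "\<exists>w\<in>W. K \<subseteq> range (glue p i j w)" if "mono_clique ?R c K" "card K = k" for c K
      using glue_covers_cliques[OF R \<open>k \<ge> 3\<close> that] .
  qed
  then obtain R' :: "colour \<Rightarrow> nat \<Rightarrow> nat \<Rightarrow> bool" and p' where R': "admissible k R' p'"
    and hom: "coloured_hom ?R R' to_nat" and p': "\<And>u. p' (to_nat u) = glued_part p u"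
    using \<open>k \<ge> 3\<close> admissible_relabel[of k ?R "glued_part p"] by auto
  have "\<exists>\<phi> d. coloured_hom R R' \<phi> \<and> (\<forall>x. p' (\<phi> x) = p x) \<and>
       (\<forall>x y. R c0 x y \<longrightarrow> p x = i \<longrightarrow> p y = j \<longrightarrow> f (\<phi> x) (\<phi> y) = d)"
    for f :: "nat \<Rightarrow> nat \<Rightarrow> colour"
  proof -
    \<comment> \<open>A word of edges is itself an edge of the power: it joins the word of its first
      endpoints, in part \<open>i\<close>, to the word of its second endpoints, in part
      \<open>j\<close>.\<close>
    define F where "F u = f (to_nat (Inl (i, map fst u) :: _ + ((nat \<times> nat) option list \<times> nat)))
      (to_nat (Inl (j, map snd u) :: _ + ((nat \<times> nat) option list \<times> nat)))"
      for u :: "(nat \<times> nat) list"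
    define \<chi> where "\<chi> u = (if F u = Red then 0 else 1 :: nat)" for u
    have "\<forall>u. \<chi> u < 2" by (simp add: \<chi>_def)
    then obtain w n where w: "combinatorial_line A N w"
      and n: "\<forall>a\<in>A. \<chi> (instantiate w a) = n"
      using N unfolding hales_jewett_number_def by blast
    have const: "F (instantiate w a) = (if n = 0 then Red else Blue)" if "a \<in> A" for a
      using n that by (cases "F (instantiate w a)") (auto simp: \<chi>_def)
    have "f (to_nat (glue p i j w x)) (to_nat (glue p i j w y)) = (if n = 0 then Red else Blue)"
      if "R c0 x y" "p x = i" "p y = j" for x y
    proof -
      \<comment> \<open>The point of the line \<open>w\<close> at the letter \<open>(x, y)\<close>
        is exactly the image of this edge in copy \<open>w\<close>.\<close>
      have "map fst (instantiate w (x, y)) = map (case_option x fst) w"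
        "map snd (instantiate w (x, y)) = map (case_option y snd) w"
        by (auto simp: instantiate_def split: option.split)
      then have "f (to_nat (glue p i j w x)) (to_nat (glue p i j w y)) = F (instantiate w (x, y))"
        using that \<open>i < j\<close> by (simp add: F_def glue_def)
      then show ?thesis using const[of "(x, y)"] that by (simp add: A_def)
    qed
    moreover have "coloured_hom R R' (\<lambda>x. to_nat (glue p i j w x))"
      using coloured_hom_copy hom by (rule coloured_hom_comp) (use w in \<open>simp add: W_def\<close>)
    moreover have "\<forall>x. p' (to_nat (glue p i j w x)) = p x" by (simp add: p')
    ultimately show ?thesis by blast
  qed
  with R' show ?thesis by blast
qed

text \<open>One partite step per pair of parts. Since copies keep their parts, constancy achieved
  for one pair survives passing to a smaller copy for the others.\<close>

lemma partite_iteration: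
  fixes R :: "colour \<Rightarrow> nat \<Rightarrow> nat \<Rightarrow> bool"
  assumes R: "admissible k R p" and "k \<ge> 3" and "finite Q"
  shows "\<exists>(R' :: colour \<Rightarrow> nat \<Rightarrow> nat \<Rightarrow> bool) p'. admissible k R' p' \<and>
    (\<forall>f :: nat \<Rightarrow> nat \<Rightarrow> colour. \<exists>\<phi> g. coloured_hom R R' \<phi> \<and> (\<forall>x. p' (\<phi> x) = p x) \<and>
       (\<forall>x y. R c0 x y \<longrightarrow> (p x, p y) \<in> Q \<longrightarrow> f (\<phi> x) (\<phi> y) = g (p x) (p y)))"
  using \<open>finite Q\<close>
proof (induction Q)
  case empty
  show ?case using R
    by (intro exI[of _ R] exI[of _ p] conjI allI exI[of _ "\<lambda>x. x"])
      (auto simp: coloured_hom_def)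
next
  case (insert q Q)
  obtain i j where q: "q = (i, j)" by fastforce
  obtain R1 :: "colour \<Rightarrow> nat \<Rightarrow> nat \<Rightarrow> bool" and p1 where R1: "admissible k R1 p1"
    and IH: "\<And>f :: nat \<Rightarrow> nat \<Rightarrow> colour. \<exists>\<phi> g. coloured_hom R R1 \<phi> \<and> (\<forall>x. p1 (\<phi> x) = p x) \<and>
       (\<forall>x y. R c0 x y \<longrightarrow> (p x, p y) \<in> Q \<longrightarrow> f (\<phi> x) (\<phi> y) = g (p x) (p y))"
    using insert.IH by blast
  obtain R2 :: "colour \<Rightarrow> nat \<Rightarrow> nat \<Rightarrow> bool" and p2 where R2: "admissible k R2 p2"
    and step: "\<And>f :: nat \<Rightarrow> nat \<Rightarrow> colour. \<exists>\<phi> d. coloured_hom R1 R2 \<phi> \<and> (\<forall>x. p2 (\<phi> x) = p1 x) \<and>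
       (\<forall>x y. R1 c0 x y \<longrightarrow> p1 x = i \<longrightarrow> p1 y = j \<longrightarrow> f (\<phi> x) (\<phi> y) = d)"
    using partite_step[OF R1 \<open>k \<ge> 3\<close>, of c0 i j] by blast
  have "\<exists>\<phi> g. coloured_hom R R2 \<phi> \<and> (\<forall>x. p2 (\<phi> x) = p x) \<and>
       (\<forall>x y. R c0 x y \<longrightarrow> (p x, p y) \<in> insert q Q \<longrightarrow> f (\<phi> x) (\<phi> y) = g (p x) (p y))"
    for f :: "nat \<Rightarrow> nat \<Rightarrow> colour"
  proof -
    obtain \<psi> d where \<psi>: "coloured_hom R1 R2 \<psi>" "\<forall>x. p2 (\<psi> x) = p1 x"
      and d: "\<forall>x y. R1 c0 x y \<longrightarrow> p1 x = i \<longrightarrow> p1 y = j \<longrightarrow> f (\<psi> x) (\<psi> y) = d"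
      using step[of f] by blast
    \<comment> \<open>The induction hypothesis is applied to \<open>f\<close> pulled back along
      \<open>\<psi>\<close>, hence inside a copy of \<open>R1\<close> on which the pair
      \<open>q\<close> is already settled.\<close>
    obtain \<phi> g where \<phi>: "coloured_hom R R1 \<phi>" "\<forall>x. p1 (\<phi> x) = p x"
      and g: "\<forall>x y. R c0 x y \<longrightarrow> (p x, p y) \<in> Q \<longrightarrow> f (\<psi> (\<phi> x)) (\<psi> (\<phi> y)) = g (p x) (p y)"
      using IH[of "\<lambda>x y. f (\<psi> x) (\<psi> y)"] by blast
    have "f (\<psi> (\<phi> x)) (\<psi> (\<phi> y)) = (if (p x, p y) = q then d else g (p x) (p y))"
      if "R c0 x y" "(p x, p y) \<in> insert q Q" for x y
      using that d g \<phi> q by (auto simp: coloured_hom_def)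
    moreover have "coloured_hom R R2 (\<lambda>x. \<psi> (\<phi> x))"
      using \<phi>(1) \<psi>(1) by (rule coloured_hom_comp)
    ultimately show ?thesis using \<phi>(2) \<psi>(2)
      by (intro exI[of _ "\<lambda>x. \<psi> (\<phi> x)"] exI[of _ "\<lambda>a b. if (a, b) = q then d else g a b"]) simp
  qed
  with R2 show ?case by blast
qed

section \<open>Making one colour class, then both, monochromatic\<close>

text \<open>Ramsey's theorem with the homogeneous set listed increasingly: the list serves as an
  order-preserving relocation of part \<open>a\<close> to part \<open>e ! a\<close>.\<close>

lemma sorted_list_ramsey:
  "\<exists>n. \<forall>g :: nat \<Rightarrow> nat \<Rightarrow> colour. \<exists>e d. length e = h \<and> sorted_wrt (<) e \<and> set e \<subseteq> {..<n} \<and>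
     (\<forall>a b. a < b \<longrightarrow> b < h \<longrightarrow> g (e ! a) (e ! b) = d)"
proof -
  obtain n where n: "\<And>(V :: nat set) E. finite V \<Longrightarrow> card V \<ge> n \<Longrightarrow>
      \<exists>S \<subseteq> V. card S = h \<and> clique S E \<or> card S = h \<and> indep S E"
    using ramsey2[where 'a = nat and m = h and n = h] by blast
  have "\<exists>e d. length e = h \<and> sorted_wrt (<) e \<and> set e \<subseteq> {..<n} \<and>
     (\<forall>a b. a < b \<longrightarrow> b < h \<longrightarrow> g (e ! a) (e ! b) = d)" for g :: "nat \<Rightarrow> nat \<Rightarrow> colour"
  proof -
    \<comment> \<open>\<open>g\<close> may be asymmetric; a pair is classified by its value in
      increasing order.\<close>
    define E where "E = {{a, b} | a b. a < b \<and> g a b = Red}"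
    obtain S where S: "S \<subseteq> {..<n}" "card S = h" "clique S E \<or> indep S E"
      using n[of "{..<n}" E] by auto
    have E: "{a, b} \<in> E \<longleftrightarrow> g a b = Red" if "a < b" for a b
      using that by (auto simp: E_def doubleton_eq_iff)
    have "\<exists>d. \<forall>a\<in>S. \<forall>b\<in>S. a < b \<longrightarrow> g a b = d"
      using S(3)
    proof
      assume "clique S E"
      then have "\<forall>a\<in>S. \<forall>b\<in>S. a < b \<longrightarrow> g a b = Red"
        using E by (metis clique_def nat_neq_iff)
      then show ?thesis by blast
    next
      assume "indep S E"
      then have "\<forall>a\<in>S. \<forall>b\<in>S. a < b \<longrightarrow> g a b = Blue"
        using E by (metis (full_types) colour.exhaust indep_def nat_neq_iff)
      then show ?thesis by blast
    qed
    then obtain d where d: "\<forall>a\<in>S. \<forall>b\<in>S. a < b \<longrightarrow> g a b = d" by blast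
    have "finite S" using S(1) finite_subset by blast
    define e where "e = sorted_list_of_set S"
    have e: "length e = h" "sorted_wrt (<) e" "set e = S"
      using S(2) \<open>finite S\<close> by (auto simp: e_def)
    moreover have "g (e ! a) (e ! b) = d" if "a < b" "b < h" for a b
      using d e that by (metis nth_mem order_less_trans sorted_wrt_nth_less)
    ultimately show ?thesis using S(1) by blast
  qed
  then show ?thesis by blast
qed

text \<open>Take disjoint copies of \<open>R\<close>, one for every increasing list \<open>e\<close>
  of \<open>h\<close> parts below \<open>n\<close>, with part \<open>a\<close> moved to
  \<open>e ! a\<close>. After the partite iteration the colour of \<open>c0\<close>-edges depends
  only on the pair of parts, and Ramsey's theorem on the parts selects a copy with a single
  colour.\<close>

lemma coloured_edge_ramsey:
  fixes R :: "colour \<Rightarrow> nat \<Rightarrow> nat \<Rightarrow> bool"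
  assumes R: "admissible k R p" and "k \<ge> 3"
  obtains R' :: "colour \<Rightarrow> nat \<Rightarrow> nat \<Rightarrow> bool" and p' where "admissible k R' p'"
    "\<And>f :: nat \<Rightarrow> nat \<Rightarrow> colour.
       \<exists>\<phi> d. coloured_hom R R' \<phi> \<and> (\<forall>x y. R c0 x y \<longrightarrow> f (\<phi> x) (\<phi> y) = d)"
proof -
  have "finite ((\<lambda>(c, x, y). p y) ` {(c, x, y). R c x y})"
    using R by (simp add: admissible_def)
  \<comment> \<open>Bounding the second endpoints suffices, as first endpoints lie in smaller parts.
    Vertices on no edge may exceed \<open>h\<close>; \<open>e ! p x\<close> is then arbitrary but
    harmless.\<close>
  then obtain h where "\<forall>m \<in> (\<lambda>(c, x, y). p y) ` {(c, x, y). R c x y}. m < h"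
    using finite_nat_set_iff_bounded by blast
  then have h: "p y < h" if "R c x y" for c x y
    using that by force
  obtain n where n: "\<And>g :: nat \<Rightarrow> nat \<Rightarrow> colour. \<exists>e d. length e = h \<and> sorted_wrt (<) e \<and>
      set e \<subseteq> {..<n} \<and> (\<forall>a b. a < b \<longrightarrow> b < h \<longrightarrow> g (e ! a) (e ! b) = d)"
    using sorted_list_ramsey[of h] by blast
  define W where "W = {e. length e = h \<and> sorted_wrt (<) e \<and> set e \<subseteq> {..<n}}"
  have "W \<subseteq> {e. set e \<subseteq> {..<n} \<and> length e = h}" by (auto simp: W_def)
  then have "finite W"
    by (rule finite_subset) (simp add: finite_lists_length_eq)
  let ?R0 = "union_of_copies R W Pair" and ?p0 = "\<lambda>(e, x). e ! p x"
  have "admissible k ?R0 ?p0"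
  proof (rule admissible_union_of_copies[OF R \<open>finite W\<close>])
    show "?p0 (e, x) < ?p0 (e, y)" if "e \<in> W" "R c x y" for e c x y
    proof -
      have "p x < p y" "p y < length e" "sorted_wrt (<) e"
        using that h[OF that(2)] R by (auto simp: W_def admissible_def)
      then show ?thesis by (simp add: sorted_wrt_nth_less)
    qed
    show "R c x y" if "?R0 c (e, x) (e, y)" for e c x y
      using that by (auto simp: union_of_copies_def)
    show "\<exists>e\<in>W. K \<subseteq> range (Pair e)" if K: "mono_clique ?R0 c K" "card K = k" for c K
    proof -
      have "K \<noteq> {}" using K(2) \<open>k \<ge> 3\<close> by auto
      then obtain u where u: "u \<in> K" by blast
      have "card K \<ge> 2" using K(2) \<open>k \<ge> 3\<close> by simp
      then obtain v where "?R0 c u v \<or> ?R0 c v u"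
        by (rule mono_clique_neighbour[OF K(1) _ u])
      then have "fst u \<in> W" by (auto simp: union_of_copies_def)
      moreover have "fst v = fst u" if "v \<in> K" for v
      proof (cases "v = u")
        case False
        then have "?R0 c u v \<or> ?R0 c v u" using K(1) u that by (simp add: mono_clique_def)
        then show ?thesis by (auto simp: union_of_copies_def)
      qed simp
      then have "K \<subseteq> range (Pair (fst u))" by (metis prod.collapse rangeI subsetI)
      ultimately show ?thesis by blast
    qed
  qed
  then obtain R1 :: "colour \<Rightarrow> nat \<Rightarrow> nat \<Rightarrow> bool" and p1 where R1: "admissible k R1 p1"
    and hom1: "coloured_hom ?R0 R1 to_nat" and p1: "\<And>u. p1 (to_nat u) = ?p0 u"
    using \<open>k \<ge> 3\<close> admissible_relabel[of k ?R0 ?p0] by auto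
  obtain R2 :: "colour \<Rightarrow> nat \<Rightarrow> nat \<Rightarrow> bool" and p2 where R2: "admissible k R2 p2"
    and part: "\<And>f :: nat \<Rightarrow> nat \<Rightarrow> colour. \<exists>\<phi> g. coloured_hom R1 R2 \<phi> \<and> (\<forall>x. p2 (\<phi> x) = p1 x) \<and>
       (\<forall>x y. R1 c0 x y \<longrightarrow> (p1 x, p1 y) \<in> {..<n} \<times> {..<n} \<longrightarrow>
          f (\<phi> x) (\<phi> y) = g (p1 x) (p1 y))"
    using partite_iteration[OF R1 \<open>k \<ge> 3\<close>, of "{..<n} \<times> {..<n}" c0] by auto
  have "\<exists>\<phi> d. coloured_hom R R2 \<phi> \<and> (\<forall>x y. R c0 x y \<longrightarrow> f (\<phi> x) (\<phi> y) = d)"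
    for f :: "nat \<Rightarrow> nat \<Rightarrow> colour"
  proof -
    obtain \<psi> g where \<psi>: "coloured_hom R1 R2 \<psi>"
      and g: "\<And>x y. R1 c0 x y \<Longrightarrow> p1 x < n \<Longrightarrow> p1 y < n \<Longrightarrow> f (\<psi> x) (\<psi> y) = g (p1 x) (p1 y)"
      using part[of f] by auto
    \<comment> \<open>The list is chosen last: \<open>n\<close> works for every \<open>g\<close>,
      including the one just obtained from \<open>f\<close>.\<close>
    obtain e d where e: "e \<in> W" and d: "\<And>a b. a < b \<Longrightarrow> b < h \<Longrightarrow> g (e ! a) (e ! b) = d"
      using n[of g] by (auto simp: W_def)
    have hom: "coloured_hom R R1 (\<lambda>x. to_nat (e, x))"
      using coloured_hom_copy[OF e] hom1 by (rule coloured_hom_comp)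
    have "f (\<psi> (to_nat (e, x))) (\<psi> (to_nat (e, y))) = d" if xy: "R c0 x y" for x y
    proof -
      have lt: "p x < p y" "p y < h"
        using xy h R by (auto simp: admissible_def)
      have "e ! a < n" if "a < h" for a
        using e that nth_mem[of a e] unfolding W_def by blast
      then have "p1 (to_nat (e, x)) < n" "p1 (to_nat (e, y)) < n"
        using lt by (auto simp: p1)
      moreover have "R1 c0 (to_nat (e, x)) (to_nat (e, y))"
        using hom xy by (simp add: coloured_hom_def)
      ultimately show ?thesis using g d[OF lt] by (simp add: p1)
    qed
    with coloured_hom_comp[OF hom \<psi>] show ?thesis by blast
  qed
  with R2 that show thesis by blast
qed

text \<open>Treat red edges first, then blue edges of the result. Homomorphisms preserve colours, so
  blue constancy on a copy of \<open>R1\<close> passes to the copy of \<open>R\<close> inside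
  it.\<close>

lemma coloured_edge_ramsey_both:
  fixes R :: "colour \<Rightarrow> nat \<Rightarrow> nat \<Rightarrow> bool"
  assumes R: "admissible k R p" and "k \<ge> 3"
  obtains R' :: "colour \<Rightarrow> nat \<Rightarrow> nat \<Rightarrow> bool" and p' where "admissible k R' p'"
    "\<And>f :: nat \<Rightarrow> nat \<Rightarrow> colour.
       \<exists>\<phi> d. coloured_hom R R' \<phi> \<and> (\<forall>c x y. R c x y \<longrightarrow> f (\<phi> x) (\<phi> y) = d c)"
proof -
  obtain R1 :: "colour \<Rightarrow> nat \<Rightarrow> nat \<Rightarrow> bool" and p1 where R1: "admissible k R1 p1"
    and red: "\<And>f :: nat \<Rightarrow> nat \<Rightarrow> colour.
       \<exists>\<phi> d. coloured_hom R R1 \<phi> \<and> (\<forall>x y. R Red x y \<longrightarrow> f (\<phi> x) (\<phi> y) = d)"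
    using coloured_edge_ramsey[OF assms] by metis
  obtain R2 :: "colour \<Rightarrow> nat \<Rightarrow> nat \<Rightarrow> bool" and p2 where R2: "admissible k R2 p2"
    and blue: "\<And>f :: nat \<Rightarrow> nat \<Rightarrow> colour.
       \<exists>\<phi> d. coloured_hom R1 R2 \<phi> \<and> (\<forall>x y. R1 Blue x y \<longrightarrow> f (\<phi> x) (\<phi> y) = d)"
    using coloured_edge_ramsey[OF R1 \<open>k \<ge> 3\<close>] by metis
  have "\<exists>\<phi> d. coloured_hom R R2 \<phi> \<and> (\<forall>c x y. R c x y \<longrightarrow> f (\<phi> x) (\<phi> y) = d c)"
    for f :: "nat \<Rightarrow> nat \<Rightarrow> colour"
  proof -
    obtain \<psi> b where \<psi>: "coloured_hom R1 R2 \<psi>" "\<forall>x y. R1 Blue x y \<longrightarrow> f (\<psi> x) (\<psi> y) = b"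
      using blue by blast
    obtain \<phi> r where \<phi>: "coloured_hom R R1 \<phi>"
      "\<forall>x y. R Red x y \<longrightarrow> f (\<psi> (\<phi> x)) (\<psi> (\<phi> y)) = r"
      using red[of "\<lambda>x y. f (\<psi> x) (\<psi> y)"] by blast
    have "f (\<psi> (\<phi> x)) (\<psi> (\<phi> y)) = (case c of Red \<Rightarrow> r | Blue \<Rightarrow> b)" if "R c x y" for c x y
      using that \<phi> \<psi>(2) by (cases c) (auto simp: coloured_hom_def)
    with coloured_hom_comp[OF \<phi>(1) \<psi>(1)] show ?thesis
      by (intro exI[of _ "\<lambda>x. \<psi> (\<phi> x)"] exI[of _ "case_colour r b"]) auto
  qed
  with R2 that show thesis by blast
qed

section \<open>Critical colourings of complete graphs\<close>

lemma has_coloured_clique_complete_graph: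
  "has_coloured_clique (complete_graph n) f c m \<longleftrightarrow>
     (\<exists>K \<subseteq> {..<n}. card K = m \<and> (\<forall>x\<in>K. \<forall>y\<in>K. x \<noteq> y \<longrightarrow> f {x, y} = c))"
proof -
  have "clique K {e \<in> [{..<n}]\<^bsup>2\<^esup>. f e = c} \<longleftrightarrow>
      (\<forall>x\<in>K. \<forall>y\<in>K. x \<noteq> y \<longrightarrow> f {x, y} = c)" if "K \<subseteq> {..<n}" for K
    using that by (auto simp: clique_def)
  moreover have "K \<in> [{..<n}]\<^bsup>m\<^esup> \<longleftrightarrow> K \<subseteq> {..<n} \<and> card K = m" for K
    by (auto simp: nsets_def finite_subset)
  ultimately show ?thesis
    unfolding has_coloured_clique_def complete_graph_def fst_conv snd_conv Bex_def
    by (intro ex_cong1) blast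
qed

text \<open>A clique on \<open>k\<close> vertices needs that many vertices. For positive
  \<open>k\<close> this makes \<open>ramsey_number k - 1\<close> a genuine predecessor.\<close>

lemma le_ramsey_number: "k \<le> ramsey_number k"
proof -
  obtain K where "K \<subseteq> {..<ramsey_number k}" "card K = k"
    using arrows_ramsey_number[of k]
    unfolding arrows_def has_coloured_clique_complete_graph by blast
  then show ?thesis using card_mono[of "{..<ramsey_number k}" K] by simp
qed

text \<open>Joining a new vertex in colour \<open>c\<close> to a critical colouring creates a monochromatic
  clique, which must have colour \<open>c\<close> and pass through the new vertex.\<close>

lemma critical_colouring:
  assumes "k \<ge> 2"
  obtains f where
    "\<And>c. \<not> has_coloured_clique (complete_graph (ramsey_number k - 1)) f c k"
    "\<And>c. has_coloured_clique (complete_graph (ramsey_number k - 1)) f c (k - 1)"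
proof -
  define s where "s = ramsey_number k - 1"
  have s: "ramsey_number k = Suc s" using le_ramsey_number[of k] assms by (simp add: s_def)
  then have "\<not> arrows (complete_graph s) k k"
    unfolding ramsey_number_def by (metis lessI not_less_Least)
  then obtain f where f: "\<not> has_coloured_clique (complete_graph s) f c k" for c
    unfolding arrows_def by (metis colour.exhaust)
  have "has_coloured_clique (complete_graph s) f c (k - 1)" for c
  proof -
    define f' where "f' e = (if s \<in> e then c else f e)" for e
    obtain c' where "has_coloured_clique (complete_graph (Suc s)) f' c' k"
      using arrows_ramsey_number[of k] unfolding s arrows_def by blast
    then obtain K where K: "K \<subseteq> {..<Suc s}" "card K = k"
      and mono: "\<And>x y. x \<in> K \<Longrightarrow> y \<in> K \<Longrightarrow> x \<noteq> y \<Longrightarrow> f' {x, y} = c'"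
      unfolding has_coloured_clique_complete_graph by auto
    have sub: "K - {s} \<subseteq> {..<s}" using K(1) by (auto simp: less_Suc_eq)
    have f_mono: "f {x, y} = c'" if "x \<in> K - {s}" "y \<in> K - {s}" "x \<noteq> y" for x y
      using mono[of x y] that by (simp add: f'_def)
    have "s \<in> K"
    proof (rule ccontr)
      assume "s \<notin> K"
      then have "has_coloured_clique (complete_graph s) f c' k"
        unfolding has_coloured_clique_complete_graph
        using sub f_mono K(2) by (intro exI[of _ K]) auto
      with f show False by blast
    qed
    then have card: "card (K - {s}) = k - 1" using K by (simp add: finite_subset)
    \<comment> \<open>A second vertex exists because \<open>k \<ge> 2\<close>; its edge to
      \<open>s\<close> has colour \<open>c\<close> under \<open>f'\<close>, which identifies
      \<open>c'\<close>.\<close>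
    then have "K - {s} \<noteq> {}"
      using assms by (metis card.empty diff_is_0_eq Suc_1 not_less_eq_eq)
    then obtain x where "x \<in> K" "x \<noteq> s" by blast
    with mono[OF _ \<open>s \<in> K\<close>] have "c' = c" by (simp add: f'_def)
    with sub f_mono card show ?thesis
      unfolding has_coloured_clique_complete_graph by blast
  qed
  with f show thesis using that unfolding s_def by blast
qed

text \<open>Every vertex is its own part and edges point upwards. Clique vertices are below
  \<open>n\<close> because each lies on an edge.\<close>

lemma admissible_complete_graph:
  assumes "\<And>c. \<not> has_coloured_clique (complete_graph n) f c k" and "k \<ge> 2"
  shows "admissible k (\<lambda>c x y. x < y \<and> y < n \<and> f {x, y} = c) (\<lambda>x. x)"
proof -
  let ?R = "\<lambda>c x y. x < y \<and> y < n \<and> f {x, y} = c"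
  have "finite {(c, x, y). ?R c x y}"
  proof (rule finite_subset)
    show "{(c, x, y). ?R c x y} \<subseteq> (\<lambda>(x, y). (f {x, y}, x, y)) ` ({..<n} \<times> {..<n})"
      by force
  qed simp
  moreover have "card K \<noteq> k" if K: "mono_clique ?R c K" for c K
  proof
    assume k: "card K = k"
    have "x < n" if "x \<in> K" for x
      using mono_clique_neighbour[OF K _ that] k \<open>k \<ge> 2\<close> by fastforce
    moreover have "f {x, y} = c" if "x \<in> K" "y \<in> K" "x \<noteq> y" for x y
      using K that unfolding mono_clique_def by (metis insert_commute)
    ultimately have "has_coloured_clique (complete_graph n) f c k"
      unfolding has_coloured_clique_complete_graph using k by blast
    with assms(1) show False by blast
  qed
  ultimately show ?thesis by (simp add: admissible_def)
qed

section \<open>From coloured oriented graphs to simple graphs\<close>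

text \<open>Only endpoints of edges become vertices, so finitely many edges give a finite
  graph.\<close>

definition underlying_graph :: "(colour \<Rightarrow> 'a \<Rightarrow> 'a \<Rightarrow> bool) \<Rightarrow> 'a graph" where
  "underlying_graph R =
     (\<Union>{{x, y} | c x y. R c x y}, {{x, y} | c x y. R c x y})"

lemma underlying_graph_edge: "{x, y} \<in> snd (underlying_graph R) \<longleftrightarrow> (\<exists>c. R c x y \<or> R c y x)"
  by (auto simp: underlying_graph_def doubleton_eq_iff)

lemma underlying_graph_vertex:
  "x \<in> fst (underlying_graph R) \<longleftrightarrow> (\<exists>c y. R c x y \<or> R c y x)"
  by (auto simp: underlying_graph_def)

lemma simple_graph_underlying_graph:
  assumes "admissible k R p"
  shows "simple_graph (underlying_graph R)"
proof -
  have "fst (underlying_graph R) \<subseteq>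
      (\<lambda>(c, x, y). x) ` {(c, x, y). R c x y} \<union> (\<lambda>(c, x, y). y) ` {(c, x, y). R c x y}"
    by (force simp: underlying_graph_vertex)
  then have "finite (fst (underlying_graph R))"
    by (rule finite_subset) (use assms in \<open>simp add: admissible_def\<close>)
  moreover have "snd (underlying_graph R) \<subseteq> [fst (underlying_graph R)]\<^bsup>2\<^esup>"
  proof
    fix e assume "e \<in> snd (underlying_graph R)"
    then obtain c x y where e: "e = {x, y}" "R c x y" by (auto simp: underlying_graph_def)
    then have "x \<noteq> y" using assms unfolding admissible_def by blast
    with e show "e \<in> [fst (underlying_graph R)]\<^bsup>2\<^esup>"
      by (auto simp: underlying_graph_vertex)
  qed
  ultimately show ?thesis by (simp add: simple_graph_def)
qed

text \<open>The colours of \<open>R\<close> themselves are the witnessing colouring.\<close>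

lemma not_arrows_underlying_graph:
  assumes R: "admissible k R p"
  shows "\<not> arrows (underlying_graph R) k k"
proof -
  \<comment> \<open>\<open>Blue\<close> is the default, also for sets that are not edges; an edge
    that is red in neither orientation must be blue in \<open>R\<close>.\<close>
  define f where "f e = (if \<exists>x y. e = {x, y} \<and> R Red x y then Red else Blue)" for e
  have edge: "R c x y \<or> R c y x" if "{x, y} \<in> snd (underlying_graph R)" "f {x, y} = c" for c x y
  proof (cases c)
    case Red
    with that(2) show ?thesis by (auto simp: f_def doubleton_eq_iff split: if_splits)
  next
    case Blue
    with that(2) have "\<not> R Red x y" "\<not> R Red y x"
      by (auto simp: f_def insert_commute split: if_splits)
    with that(1) Blue show ?thesis
      unfolding underlying_graph_edge by (metis colour.exhaust)
  qed
  have "\<not> has_coloured_clique (underlying_graph R) f c k" for c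
  proof
    assume "has_coloured_clique (underlying_graph R) f c k"
    then obtain K where "card K = k" "clique K {e \<in> snd (underlying_graph R). f e = c}"
      by (auto simp: has_coloured_clique_def nsets_def)
    then have "mono_clique R c K" using edge by (auto simp: mono_clique_def clique_def)
    with R \<open>card K = k\<close> show False by (auto simp: admissible_def)
  qed
  then show ?thesis by (auto simp: arrows_def)
qed

text \<open>Edges of \<open>R\<close> join distinct parts, so \<open>\<phi>\<close> is injective on
  \<open>K\<close> and the image keeps its size. With at least two elements in \<open>K\<close>,
  every image lies on an edge and is thus a vertex.\<close>

lemma has_coloured_clique_hom_image:
  fixes K :: "nat set"
  assumes R: "admissible k R p" and "card K \<ge> 2"
    and K: "\<And>x y. x \<in> K \<Longrightarrow> y \<in> K \<Longrightarrow> x < y \<Longrightarrow>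
              (\<exists>b. R b (\<phi> x) (\<phi> y)) \<and> f {\<phi> x, \<phi> y} = c"
  shows "has_coloured_clique (underlying_graph R) f c (card K)"
proof -
  have edge: "\<phi> x \<noteq> \<phi> y \<and> (\<exists>b. R b (\<phi> x) (\<phi> y) \<or> R b (\<phi> y) (\<phi> x)) \<and> f {\<phi> x, \<phi> y} = c"
    if "x \<in> K" "y \<in> K" "x \<noteq> y" for x y
  proof (cases "x < y")
    case True
    then show ?thesis using K[OF that(1,2)] R unfolding admissible_def by (metis less_irrefl)
  next
    case False
    then show ?thesis using K[OF that(2,1)] that(3) R unfolding admissible_def
      by (metis insert_commute less_irrefl linorder_neqE_nat)
  qed
  have "finite K" using \<open>card K \<ge> 2\<close> card.infinite by fastforce
  have "inj_on \<phi> K" using edge by (meson inj_onI)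
  have "\<phi> x \<in> fst (underlying_graph R)" if "x \<in> K" for x
  proof -
    have "\<not> K \<subseteq> {x}" using \<open>card K \<ge> 2\<close> card_mono[of "{x}" K] by auto
    then obtain y where "y \<in> K" "y \<noteq> x" by blast
    with edge[OF that] show ?thesis unfolding underlying_graph_vertex by metis
  qed
  then have "\<phi> ` K \<in> [fst (underlying_graph R)]\<^bsup>card K\<^esup>"
    using \<open>finite K\<close> card_image[OF \<open>inj_on \<phi> K\<close>] by (auto simp: nsets_def)
  moreover have "clique (\<phi> ` K) {e \<in> snd (underlying_graph R). f e = c}"
    unfolding clique_def using edge by (auto simp: underlying_graph_edge)
  ultimately show ?thesis unfolding has_coloured_clique_def by blast
qed

theorem theorem1p2:
  fixes k :: nat
  assumes "k \<ge> 3"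
  shows "\<exists>G :: nat graph. simple_graph G \<and>
           \<not> arrows G k k \<and> arrows G (ramsey_number k - 1) (k - 1)"
proof -
  define s where "s = ramsey_number k - 1"
  have "s \<ge> 2" using le_ramsey_number[of k] assms by (simp add: s_def)
  obtain \<chi> where no_k: "\<And>c. \<not> has_coloured_clique (complete_graph s) \<chi> c k"
    and pred_k: "\<And>c. has_coloured_clique (complete_graph s) \<chi> c (k - 1)"
    using critical_colouring[of k] assms unfolding s_def by auto
  define H where "H = (\<lambda>c x y. x < y \<and> y < s \<and> \<chi> {x, y} = c)"
  have "admissible k H (\<lambda>x. x)"
    unfolding H_def using admissible_complete_graph[OF no_k] assms by simp
  then obtain R :: "colour \<Rightarrow> nat \<Rightarrow> nat \<Rightarrow> bool" and p where R: "admissible k R p"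
    and ramsey: "\<And>f :: nat \<Rightarrow> nat \<Rightarrow> colour.
       \<exists>\<phi> d. coloured_hom H R \<phi> \<and> (\<forall>c x y. H c x y \<longrightarrow> f (\<phi> x) (\<phi> y) = d c)"
    using coloured_edge_ramsey_both[OF _ assms] by metis
  have "has_coloured_clique (underlying_graph R) f Red s \<or>
      has_coloured_clique (underlying_graph R) f Blue (k - 1)" for f
  proof -
    \<comment> \<open>The set colouring \<open>f\<close> is read as a symmetric colouring of ordered
      pairs; \<open>d\<close> sends each original colour to the one its edges receive in the
      copy.\<close>
    obtain \<phi> d where hom: "coloured_hom H R \<phi>"
      and d: "\<And>c x y. H c x y \<Longrightarrow> f {\<phi> x, \<phi> y} = d c"
      using ramsey[of "\<lambda>x y. f {x, y}"] by blast
    have edge: "(\<exists>b. R b (\<phi> x) (\<phi> y)) \<and> f {\<phi> x, \<phi> y} = d (\<chi> {x, y})" if "x < y" "y < s" for x y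
    proof -
      have "H (\<chi> {x, y}) x y" using that by (simp add: H_def)
      then show ?thesis using d hom unfolding coloured_hom_def by blast
    qed
    show ?thesis
    proof (cases "\<forall>c. d c = Red")
      case True
      then have "has_coloured_clique (underlying_graph R) f Red (card {..<s})"
        using edge \<open>s \<ge> 2\<close> by (intro has_coloured_clique_hom_image[OF R, of _ \<phi>]) auto
      then show ?thesis by simp
    next
      case False
      then obtain c where c: "d c = Blue" by (metis colour.exhaust)
      obtain K where K: "K \<subseteq> {..<s}" "card K = k - 1"
        and mono: "\<forall>x\<in>K. \<forall>y\<in>K. x \<noteq> y \<longrightarrow> \<chi> {x, y} = c"
        using pred_k[of c] unfolding has_coloured_clique_complete_graph by blast
      have "(\<exists>b. R b (\<phi> x) (\<phi> y)) \<and> f {\<phi> x, \<phi> y} = Blue" if "x \<in> K" "y \<in> K" "x < y" for x y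
        using edge[of x y] that K(1) mono c by auto
      then have "has_coloured_clique (underlying_graph R) f Blue (card K)"
        using K(2) assms by (intro has_coloured_clique_hom_image[OF R, of _ \<phi>]) auto
      then show ?thesis using K(2) by simp
    qed
  qed
  then have "arrows (underlying_graph R) s (k - 1)" by (simp add: arrows_def)
  with simple_graph_underlying_graph[OF R] not_arrows_underlying_graph[OF R] show ?thesis
    unfolding s_def by blast
qed

end
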